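(* Let $q,\xi\in[0,1)$, let $N\ge1$ be an integer, and let $\lambda$ be a random partition distributed according to the squared type $q$-Plancherel measure $\mu_{q\mathrm{PP}_S}[\,\cdot\,;\xi,q]$. Then $$\mathbb{P}_{q\mathrm{PP}_S}[\ell(\lambda)\le N]=\frac1{M(\xi;q)}\det_{0\le i,j\le N-1}I_{-i+j},\qquad \mathbb{P}_{q\mathrm{PP}_S}[\lambda_1\le N]=\frac1{M(\xi;q)}\det_{0\le i,j\le N-1}\check I_{-i+j},$$ where $I_n=I^{(1)}_n(2\xi q^{\frac12};q)$ and $\check I_n=q^{\frac{n^2}2}I^{(2)}_n(2\xi;q)$ are given by modified $q$-Bessel functions and $M(\xi;q)$ is the modified MacMahon function.
   Context: Let $\mathsf{P}$ be the set of all integer partitions $\lambda=(\lambda_1\ge\lambda_2\ge\cdots)$ (including the empty one), with length $\ell(\lambda)$, transpose $\lambda^{\mathrm T}$, size $|\lambda|=\sum_i\lambda_i$, $b(\lambda)=\sum_{i\ge1}(i-1)\lambda_i$, and hook lengths $h(i,j)=\lambda_i+\lambda^{\mathrm T}_j-i-j+1$ for $(i,j)\in\lambda$. The modified MacMahon function is $M(\xi;q)=\prod_{n\ge1}(1-\xi^2q^n)^{-n}$, and the squared type $q$-Plancherel measure is the probability measure on $\mathsf{P}$ $$\mu_{q\mathrm{PP}_S}[\lambda;\xi,q]=M(\xi;q)^{-1}(\xi^2q)^{|\lambda|}q^{2b(\lambda)}\prod_{(i,j)\in\lambda}\frac1{(1-q^{h(i,j)})^2}.$$ With $(q;q)_k=\prod_{j=1}^k(1-q^j)$,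 the modified $q$-Bessel functions of integer order $n$ are $$I^{(1)}_n(x;q)=\sum_{k\ge\max(0,-n)}\frac{(x/2)^{n+2k}}{(q;q)_k(q;q)_{n+k}}\ \ (|x|<2),\qquad I^{(2)}_n(x;q)=\sum_{k\ge\max(0,-n)}\frac{q^{k(k+n)}(x/2)^{n+2k}}{(q;q)_k(q;q)_{n+k}},$$ with the convention $0^0=1$. *)

theory Defs
  imports "HOL-Probability.Probability" "Jordan_Normal_Form.Determinant"
begin

text \<open>Partitions are weakly decreasing sequences of naturals with finitely many nonzero terms.
  Indexing starts at 0: the part usually written $\lambda_i$ is \<open>l (i - 1)\<close>; in particular the
  largest part is \<open>l 0\<close>. Cells of the Young diagram are indexed from \<open>(0, 0)\<close> accordingly.\<close>

definition partitions :: "(nat \<Rightarrow> nat) set" where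
  "partitions = {l. antimono l \<and> finite {i. l i \<noteq> 0}}"

definition plength :: "(nat \<Rightarrow> nat) \<Rightarrow> nat" where
  "plength l = card {i. l i \<noteq> 0}"

definition ptranspose :: "(nat \<Rightarrow> nat) \<Rightarrow> nat \<Rightarrow> nat" where
  "ptranspose l j = card {i. j < l i}"

definition psize :: "(nat \<Rightarrow> nat) \<Rightarrow> nat" where
  "psize l = (\<Sum>i | l i \<noteq> 0. l i)"

definition pb :: "(nat \<Rightarrow> nat) \<Rightarrow> nat" where
  "pb l = (\<Sum>i | l i \<noteq> 0. i * l i)"

definition cells :: "(nat \<Rightarrow> nat) \<Rightarrow> (nat \<times> nat) set" where
  "cells l = {(i, j). j < l i}"

text \<open>With 1-based cells this is $\lambda_i + \lambda^{\mathrm T}_j - i - j + 1$; shifting both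
  indices by one turns the final $+1$ into $-1$. For \<open>(i, j) \<in> cells l\<close> the truncated
  subtraction is exact and the value is at least 1.\<close>

definition hook_length :: "(nat \<Rightarrow> nat) \<Rightarrow> nat \<Rightarrow> nat \<Rightarrow> nat" where
  "hook_length l i j = l i + ptranspose l j - i - j - 1"

definition macmahon :: "real \<Rightarrow> real \<Rightarrow> real" where
  "macmahon \<xi> q = (\<Prod>n. 1 / (1 - \<xi>\<^sup>2 * q ^ Suc n) ^ Suc n)"

definition qPP_S_weight :: "real \<Rightarrow> real \<Rightarrow> (nat \<Rightarrow> nat) \<Rightarrow> real" where
  "qPP_S_weight \<xi> q l =
     inverse (macmahon \<xi> q) * (\<xi>\<^sup>2 * q) ^ psize l * q ^ (2 * pb l) *
     (\<Prod>(i, j)\<in>cells l. 1 / (1 - q ^ hook_length l i j)\<^sup>2)"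

definition qPP_S :: "real \<Rightarrow> real \<Rightarrow> (nat \<Rightarrow> nat) measure" where
  "qPP_S \<xi> q = point_measure partitions (\<lambda>l. ennreal (qPP_S_weight \<xi> q l))"

definition q_poch :: "real \<Rightarrow> nat \<Rightarrow> real" where
  "q_poch q k = (\<Prod>j=1..k. 1 - q ^ j)"

text \<open>In the summation range \<open>n + k\<close> and \<open>n + 2 * k\<close> are nonnegative, so the conversions to
  \<open>nat\<close> are exact, and the \<open>nat\<close>-exponent power has \<open>0 ^ 0 = 1\<close>. The first series is only
  meaningful for \<open>\<bar>x\<bar> < 2\<close>.\<close>

definition q_Bessel_I1 :: "int \<Rightarrow> real \<Rightarrow> real \<Rightarrow> real" where
  "q_Bessel_I1 n x q =
     (\<Sum>\<^sub>\<infinity>k\<in>{k::nat. max 0 (- n) \<le> int k}.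
        (x / 2) ^ nat (n + 2 * int k) / (q_poch q k * q_poch q (nat (n + int k))))"

definition q_Bessel_I2 :: "int \<Rightarrow> real \<Rightarrow> real \<Rightarrow> real" where
  "q_Bessel_I2 n x q =
     (\<Sum>\<^sub>\<infinity>k\<in>{k::nat. max 0 (- n) \<le> int k}.
        q ^ nat (int k * (int k + n)) * (x / 2) ^ nat (n + 2 * int k) /
          (q_poch q k * q_poch q (nat (n + int k))))"

definition I_entry :: "real \<Rightarrow> real \<Rightarrow> int \<Rightarrow> real" where
  "I_entry \<xi> q n = q_Bessel_I1 n (2 * \<xi> * sqrt q) q"

text \<open>The factor $q^{n^2/2}$ is a natural power of \<open>sqrt q\<close> rather than a \<open>powr\<close>, because
  \<open>0 powr 0 = 0\<close> would give the wrong value for \<open>q = 0\<close> and \<open>n = 0\<close>.\<close>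

definition I_check_entry :: "real \<Rightarrow> real \<Rightarrow> int \<Rightarrow> real" where
  "I_check_entry \<xi> q n = sqrt q ^ nat (n\<^sup>2) * q_Bessel_I2 n (2 * \<xi>) q"

end

theory Submission
  imports Defs
begin

text \<open>Up to the factor $1 / M(\xi;q)$, the weight of $\lambda$ is $s_\lambda(r, rq, rq^2, \dots)^2$ with
  $r = \xi q^{1/2}$. By Jacobi--Trudi, the specialised Schur function is the $N \times N$ minor of
  the Toeplitz matrix of $h_k = r^k / (q;q)_k$ with rows $x_a = \lambda_{N-a} + a$ ($0 \le a < N$); since each
  of its columns is, up to scaling, a Newton polynomial in $q^{x_a}$, the minor is a Vandermonde
  product, which the hook length formula identifies with the weight. Summing the squared minors over
  all $x_0 < \dots < x_{N-1}$ by an infinite Cauchy--Binet formula gives the determinant of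
  $\sum_k h_k h_{k+j-i}$ (Gessel's identity), whose entries are the Bessel functions.
  Replacing $(r, q)$ by $(-r/q, 1/q)$ turns $h_k$ into $e_k = r^k q^{k(k-1)/2} / (q;q)_k$ and the Schur function of
  $\lambda$ into that of $\lambda^{\mathrm T}$, so the same identity also yields the second formula.\<close>

section \<open>Determinants\<close>

lemma permutes_less:
  fixes p :: "nat \<Rightarrow> nat"
  assumes "p permutes {0..<n}" "i < n"
  shows "p i < n"
  using assms permutes_in_image[of p "{0..<n}" i] by simp

lemma has_sum_finite_sum:
  fixes f :: "'i \<Rightarrow> 'a \<Rightarrow> real"
  assumes "finite P" "\<And>p. p \<in> P \<Longrightarrow> (f p has_sum S p) A"
  shows "((\<lambda>x. \<Sum>p\<in>P. f p x) has_sum (\<Sum>p\<in>P. S p)) A"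
  using assms by (induction P rule: finite_induct) (auto intro: has_sum_add)

text \<open>For real series \<open>summable_on\<close> already means absolute summability, which is
  what expanding a finite product of series into one series over all tuples requires.\<close>

lemma has_sum_prod_PiE:
  fixes f :: "'i \<Rightarrow> nat \<Rightarrow> real"
  assumes "finite A" "\<And>i. i \<in> A \<Longrightarrow> f i summable_on UNIV"
  shows "((\<lambda>g. \<Prod>i\<in>A. f i (g i)) has_sum (\<Prod>i\<in>A. \<Sum>\<^sub>\<infinity>x. f i x)) (PiE A (\<lambda>_. UNIV))"
proof -
  have abs: "(\<lambda>x. norm (f i x)) summable_on UNIV" if "i \<in> A" for i
    using assms(2)[OF that] summable_on_iff_abs_summable_on_real by blast
  have "Infinite_Set_Sum.abs_summable_on (\<lambda>g. \<Prod>i\<in>A. f i (g i)) (PiE A (\<lambda>_. UNIV))"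
    using abs by (intro abs_summable_on_prod_PiE assms(1)) (auto simp: abs_summable_equivalent[symmetric])
  hence "(\<lambda>g. \<Prod>i\<in>A. f i (g i)) summable_on (PiE A (\<lambda>_. UNIV))"
    using abs_summable_equivalent abs_summable_summable by blast
  moreover have "infsum (\<lambda>g. \<Prod>i\<in>A. f i (g i)) (PiE A (\<lambda>_. UNIV)) = (\<Prod>i\<in>A. \<Sum>\<^sub>\<infinity>x. f i x)"
    using abs by (intro infsum_prod_PiE_abs assms(1)) auto
  ultimately show ?thesis
    by (simp add: has_sum_iff)
qed

text \<open>Membership in \<open>extensional\<close> fixes the values outside
  \<open>{0..<N}\<close>, so each increasing tuple is represented by exactly one function and is
  counted once in sums.\<close>

definition increasing_seqs :: "nat \<Rightarrow> (nat \<Rightarrow> nat) set" where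
  "increasing_seqs N = {g \<in> extensional {0..<N}. strict_mono_on {0..<N} g}"

text \<open>Both functions list the common image in increasing order, and a sorted list without
  repetitions is determined by its set.\<close>

lemma increasing_seqs_eqI:
  assumes "g \<in> increasing_seqs N" "h \<in> increasing_seqs N" "g ` {0..<N} = h ` {0..<N}"
  shows "g = h"
proof -
  have srt: "sorted (map f [0..<N])" "distinct (map f [0..<N])" if "f \<in> increasing_seqs N" for f
    using that unfolding increasing_seqs_def
    by (auto simp: sorted_iff_nth_mono distinct_map
        intro: strict_mono_on_imp_inj_on strict_mono_on_leD[of "{0..<N}"])
  have "map g [0..<N] = map h [0..<N]"
    using srt assms by (intro sorted_distinct_set_unique) auto
  then have "\<forall>i\<in>{0..<N}. g i = h i" by simp
  then show ?thesis
    using assms(1,2) unfolding increasing_seqs_def by (auto intro: extensionalityI)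
qed

text \<open>An injective tuple is its sorted rearrangement composed with the permutation recording
  the rank of each entry. The rearrangement depends on the image only, and its injectivity then
  determines the permutation.\<close>

lemma bij_betw_increasing_seqs_permutations:
  "bij_betw (\<lambda>(g, p). restrict (g \<circ> p) {0..<N})
     (increasing_seqs N \<times> {p. p permutes {0..<N}})
     {f \<in> extensional {0..<N}. inj_on f {0..<N}}"
  unfolding bij_betw_def
proof (intro conjI subset_antisym subsetI)
  show "inj_on (\<lambda>(g, p). restrict (g \<circ> p) {0..<N})
     (increasing_seqs N \<times> {p. p permutes {0..<N}})"
  proof (rule inj_onI, clarify)
    fix g p h r
    assume g: "g \<in> increasing_seqs N" and h: "h \<in> increasing_seqs N"
      and p: "p permutes {0..<N}" and r: "r permutes {0..<N}"
      and eq: "restrict (g \<circ> p) {0..<N} = restrict (h \<circ> r) {0..<N}"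
    have pt: "g (p i) = h (r i)" if "i < N" for i
      using fun_cong[OF eq, of i] that by simp
    have "g ` {0..<N} = g ` (p ` {0..<N})" using permutes_image[OF p] by simp
    also have "\<dots> = h ` (r ` {0..<N})" using pt by (auto simp: image_image)
    finally have "g = h" using g h permutes_image[OF r] by (intro increasing_seqs_eqI) auto
    moreover have "inj_on g {0..<N}"
      using g unfolding increasing_seqs_def by (auto intro: strict_mono_on_imp_inj_on)
    ultimately have "p i = r i" if "i < N" for i
      using pt[OF that] that permutes_in_image[OF p, of i] permutes_in_image[OF r, of i]
      by (auto dest: inj_onD)
    moreover have "p i = r i" if "\<not> i < N" for i
      using that permutes_not_in[OF p, of i] permutes_not_in[OF r, of i] by auto
    ultimately show "g = h \<and> p = r" using \<open>g = h\<close> by auto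
  qed
next
  fix f assume "f \<in> (\<lambda>(g, p). restrict (g \<circ> p) {0..<N}) ` (increasing_seqs N \<times> {p. p permutes {0..<N}})"
  then obtain g p where *: "g \<in> increasing_seqs N" "p permutes {0..<N}" "f = restrict (g \<circ> p) {0..<N}"
    by auto
  have "inj_on g (p ` {0..<N})"
    using * permutes_image[of p] unfolding increasing_seqs_def by (auto intro: strict_mono_on_imp_inj_on)
  then have "inj_on (g \<circ> p) {0..<N}"
    using * by (intro comp_inj_on) (auto simp: permutes_inj_on)
  then show "f \<in> {f \<in> extensional {0..<N}. inj_on f {0..<N}}"
    using * by (auto simp: inj_on_def)
next
  fix f :: "nat \<Rightarrow> nat" assume "f \<in> {f \<in> extensional {0..<N}. inj_on f {0..<N}}"
  then have ext: "f \<in> extensional {0..<N}" and inj: "inj_on f {0..<N}" by auto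
  define xs where "xs = sorted_list_of_set (f ` {0..<N})"
  have len: "length xs = N" by (simp add: xs_def card_image[OF inj])
  have srt: "sorted_wrt (<) xs" by (simp add: xs_def)
  have set: "set xs = f ` {0..<N}" by (simp add: xs_def)
  define g where "g = restrict ((!) xs) {0..<N}"
  have g: "g \<in> increasing_seqs N"
    unfolding increasing_seqs_def g_def using srt len
    by (auto intro!: strict_mono_onI simp: sorted_wrt_iff_nth_less)
  have gim: "g ` {0..<N} = f ` {0..<N}"
    unfolding set[symmetric] set_conv_nth g_def len by auto
  \<comment> \<open>\<open>p i\<close> is the rank of \<open>f i\<close> in the image; off the range
    the value \<open>i\<close> is what \<open>permutes\<close> demands.\<close>
  define p where "p i = (if i < N then inv_into {0..<N} g (f i) else i)" for i
  have gp: "g (p i) = f i" if "i < N" for i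
    using that gim by (auto simp: p_def intro!: f_inv_into_f)
  have pN: "p i < N" if "i < N" for i
    using that gim inv_into_into[of "f i" g "{0..<N}"] by (auto simp: p_def)
  have "bij_betw p {0..<N} {0..<N}"
  proof -
    have inj': "inj_on p {0..<N}"
    proof (rule inj_onI)
      fix i j assume "i \<in> {0..<N}" "j \<in> {0..<N}" "p i = p j"
      then have "f i = f j" using gp[of i] gp[of j] by simp
      then show "i = j" using inj \<open>i \<in> _\<close> \<open>j \<in> _\<close> by (auto dest: inj_onD)
    qed
    have "p ` {0..<N} = {0..<N}"
      using pN inj' by (intro endo_inj_surj) auto
    with inj' show ?thesis by (simp add: bij_betw_def)
  qed
  then have p: "p permutes {0..<N}"
    by (rule bij_imp_permutes) (auto simp: p_def)
  have "f = restrict (g \<circ> p) {0..<N}"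
    using ext gp by (intro extensionalityI[of f "{0..<N}"]) auto
  then show "f \<in> (\<lambda>(g, p). restrict (g \<circ> p) {0..<N}) ` (increasing_seqs N \<times> {p. p permutes {0..<N}})"
    using g p by force
qed

text \<open>Expanding the determinant of series turns it into one sum over all tuples
  \<open>f\<close>. Tuples with a repeated entry contribute nothing, and the others are grouped by
  their sorted rearrangement \<open>g\<close>; summing over the permutations in each group rebuilds
  the two minors.\<close>

theorem cauchy_binet_infinite:
  fixes a b :: "nat \<Rightarrow> nat \<Rightarrow> real"
  assumes "\<And>i j. i < N \<Longrightarrow> j < N \<Longrightarrow> (\<lambda>x. a i x * b j x) summable_on UNIV"
  shows "((\<lambda>g. Determinant.det (Matrix.mat N N (\<lambda>(k, i). a i (g k))) *
              Determinant.det (Matrix.mat N N (\<lambda>(k, j). b j (g k)))) has_sum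
          Determinant.det (Matrix.mat N N (\<lambda>(i, j). \<Sum>\<^sub>\<infinity>x. a i x * b j x))) (increasing_seqs N)"
proof -
  define P where "P = {p. p permutes {0..<N}}"
  define B where "B f = Matrix.mat N N (\<lambda>(k, j). b j (f k))" for f :: "nat \<Rightarrow> nat"
  define A where "A f = Matrix.mat N N (\<lambda>(k, i). a i (f k))" for f :: "nat \<Rightarrow> nat"
  define T where "T = Matrix.mat N N (\<lambda>(i, j). \<Sum>\<^sub>\<infinity>x. a i x * b j x)"
  have [simp]: "B f \<in> carrier_mat N N" "A f \<in> carrier_mat N N" "T \<in> carrier_mat N N" for f
    by (auto simp: B_def A_def T_def)
  have finP: "finite P" by (simp add: P_def finite_permutations)
  have lt: "p i < N" if "p \<in> P" "i < N" for p i
    using that by (simp add: P_def permutes_less)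
  have det_B: "Determinant.det (B f) = (\<Sum>p\<in>P. signof p * (\<Prod>i=0..<N. b (p i) (f i)))" for f
    unfolding P_def by (subst det_def'[of _ N]) (auto simp: B_def permutes_less intro!: sum.cong prod.cong)
  have det_T: "Determinant.det T = (\<Sum>p\<in>P. signof p * (\<Prod>i=0..<N. \<Sum>\<^sub>\<infinity>x. a i x * b (p i) x))"
    unfolding P_def by (subst det_def'[of _ N]) (auto simp: T_def permutes_less intro!: sum.cong prod.cong)
  have det_A: "Determinant.det (A f) = (\<Sum>p\<in>P. signof p * (\<Prod>i=0..<N. a i (f (p i))))" for f :: "nat \<Rightarrow> nat"
  proof -
    have "Determinant.det (A f) = Determinant.det (transpose_mat (A f))"
      by (simp add: Determinant.det_transpose[of _ N])
    also have "\<dots> = (\<Sum>p\<in>P. signof p * (\<Prod>i=0..<N. a i (f (p i))))"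
      unfolding P_def by (subst det_def'[of _ N]) (auto simp: A_def permutes_less intro!: sum.cong prod.cong)
    finally show ?thesis .
  qed
  \<comment> \<open>The sum over permutations is folded back into a determinant for \<open>b\<close>
    only; the diagonal product of the \<open>a i\<close> waits for the grouping by sorted
    tuples.\<close>
  define F where "F f = (\<Prod>i=0..<N. a i (f i)) * Determinant.det (B f)" for f :: "nat \<Rightarrow> nat"
  have F_sum: "(F has_sum Determinant.det T) (PiE {0..<N} (\<lambda>_. UNIV))"
  proof -
    have "((\<lambda>f. \<Sum>p\<in>P. signof p * (\<Prod>i=0..<N. a i (f i) * b (p i) (f i))) has_sum
        (\<Sum>p\<in>P. signof p * (\<Prod>i=0..<N. \<Sum>\<^sub>\<infinity>x. a i x * b (p i) x))) (PiE {0..<N} (\<lambda>_. UNIV))"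
      using assms lt by (intro has_sum_finite_sum finP has_sum_cmult_right has_sum_prod_PiE) auto
    moreover have "(\<lambda>f. \<Sum>p\<in>P. signof p * (\<Prod>i=0..<N. a i (f i) * b (p i) (f i))) = F"
      by (simp add: fun_eq_iff F_def det_B prod.distrib sum_distrib_left mult_ac)
    ultimately show ?thesis by (simp add: det_T)
  qed
  have "(F has_sum Determinant.det T) {f \<in> extensional {0..<N}. inj_on f {0..<N}}"
  proof (rule iffD2[OF has_sum_cong_neutral F_sum])
    fix f :: "nat \<Rightarrow> nat" assume "f \<in> PiE {0..<N} (\<lambda>_. UNIV) - {f \<in> extensional {0..<N}. inj_on f {0..<N}}"
    then obtain i j where ij: "i < N" "j < N" "i \<noteq> j" "f i = f j"
      by (auto simp: inj_on_def PiE_def)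
    then have "Matrix.row (B f) i = Matrix.row (B f) j" by (auto simp: B_def)
    then have "Determinant.det (B f) = 0"
      using ij by (intro Determinant.det_identical_rows[of _ N i j]) auto
    then show "F f = 0" by (simp add: F_def)
  qed (auto simp: PiE_def)
  then have "((\<lambda>(g, p). F (restrict (g \<circ> p) {0..<N})) has_sum Determinant.det T) (increasing_seqs N \<times> P)"
    unfolding P_def
    by (subst (asm) has_sum_reindex_bij_betw[OF bij_betw_increasing_seqs_permutations, symmetric])
       (simp add: case_prod_unfold)
  then have "((\<lambda>g. Determinant.det (A g) * Determinant.det (B g)) has_sum Determinant.det T) (increasing_seqs N)"
  proof (rule has_sum_SigmaD)
    fix g
    have "F (restrict (g \<circ> p) {0..<N}) = (signof p * (\<Prod>i=0..<N. a i (g (p i)))) * Determinant.det (B g)"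
      if "p \<in> P" for p
    proof -
      \<comment> \<open>Reordering the tuple permutes the rows of \<open>B g\<close>. The resulting
        sign completes the product of the \<open>a i\<close> to a Leibniz term of
        \<open>det (A g)\<close>.\<close>
      have "B (restrict (g \<circ> p) {0..<N}) = Matrix.mat N N (\<lambda>(i, j). B g $$ (p i, j))"
        using lt[OF that] by (intro eq_matI) (auto simp: B_def)
      then have "Determinant.det (B (restrict (g \<circ> p) {0..<N})) = signof p * Determinant.det (B g)"
        using that by (simp add: Determinant.det_permute_rows P_def)
      then show ?thesis by (simp add: F_def)
    qed
    then have "(\<Sum>p\<in>P. F (restrict (g \<circ> p) {0..<N})) = Determinant.det (A g) * Determinant.det (B g)"
      by (simp add: det_A sum_distrib_right)
    then show "((\<lambda>p. case (g, p) of (g, p) \<Rightarrow> F (restrict (g \<circ> p) {0..<N})) has_sum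
        Determinant.det (A g) * Determinant.det (B g)) P"
      using finP by (intro has_sum_finiteI) auto
  qed
  then show ?thesis by (simp add: A_def B_def T_def)
qed

text \<open>Each term of the Leibniz formula uses every row and every column exactly once.\<close>

lemma det_scale_rows_cols:
  fixes r c :: "nat \<Rightarrow> 'a :: comm_ring_1"
  shows "Determinant.det (Matrix.mat N N (\<lambda>(i, j). r i * c j * A i j)) =
         (\<Prod>i<N. r i) * (\<Prod>j<N. c j) * Determinant.det (Matrix.mat N N (\<lambda>(i, j). A i j))"
proof -
  have "(\<Prod>i=0..<N. c (p i)) = (\<Prod>j<N. c j)" if "p permutes {0..<N}" for p
    using prod.permute[OF that, of c] by (simp add: atLeast0LessThan o_def)
  then show ?thesis
    by (subst (1 2) det_def'[of _ N])
      (auto simp: permutes_less prod.distrib sum_distrib_left atLeast0LessThan mult_ac intro!: sum.cong)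
qed

text \<open>Column \<open>j\<close> is a monic polynomial of degree \<open>j\<close> in
  \<open>x i\<close>, so the nodes \<open>c\<close> cannot influence the value. The induction clears
  row 0 except for its first entry and pulls \<open>x (Suc i) - x 0\<close> out of the other
  rows.\<close>

lemma det_newton_vandermonde:
  fixes x c :: "nat \<Rightarrow> 'a :: idom"
  shows "Determinant.det (Matrix.mat N N (\<lambda>(i, j). \<Prod>s<j. x i - c s)) = (\<Prod>j<N. \<Prod>i<j. x j - x i)"
proof (induction N arbitrary: x)
  case 0
  then show ?case by simp
next
  case (Suc N)
  define V where "V = Matrix.mat (Suc N) (Suc N) (\<lambda>(i, j). \<Prod>s<j. x i - c s)"
  define U where "U = Matrix.mat (Suc N) (Suc N)
     (\<lambda>(k, j). if k = j then 1 else if Suc k = j then c k - x 0 else 0)"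
  have [simp]: "V \<in> carrier_mat (Suc N) (Suc N)" "U \<in> carrier_mat (Suc N) (Suc N)"
    by (auto simp: V_def U_def)
  \<comment> \<open>Right multiplication by \<open>U\<close> subtracts \<open>x 0 - c j\<close> times column \<open>j\<close> from column \<open>j + 1\<close>.\<close>
  define W where "W = Matrix.mat (Suc N) (Suc N)
     (\<lambda>(i, j). if j = 0 then 1 else (x i - x 0) * (\<Prod>s<j - 1. x i - c s))"
  have VU: "V * U = W"
  proof (rule eq_matI)
    fix i j assume ij: "i < dim_row W" "j < dim_col W"
    have "(V * U) $$ (i, j) = (\<Sum>k=0..<Suc N. V $$ (i, k) * U $$ (k, j))"
      using ij by (simp add: V_def U_def W_def scalar_prod_def)
    also have "\<dots> = (\<Sum>k=0..<Suc N. (if k = j then V $$ (i, k) else 0) +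
        (if Suc k = j then V $$ (i, k) * (c k - x 0) else 0))"
      using ij by (intro sum.cong) (auto simp: U_def W_def)
    also have "\<dots> = W $$ (i, j)"
      using ij by (cases j) (auto simp: sum.distrib V_def W_def algebra_simps)
    finally show "(V * U) $$ (i, j) = W $$ (i, j)" .
  qed (auto simp: V_def U_def W_def)
  have "Determinant.det U = 1"
    by (subst det_upper_triangular[of _ "Suc N"])
       (auto simp: U_def prod_list_diag_prod intro!: prod.neutral)
  then have "Determinant.det V = Determinant.det W"
    using VU Determinant.det_mult[of V "Suc N" U] by simp
  also have "\<dots> = (\<Sum>j<Suc N. W $$ (0, j) * cofactor W 0 j)"
    by (rule laplace_expansion_row) (auto simp: W_def)
  also have "\<dots> = (\<Sum>j<Suc N. if j = 0 then cofactor W 0 j else 0)"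
    by (intro sum.cong) (auto simp: W_def)
  also have "\<dots> = cofactor W 0 0" by simp
  also have "\<dots> = Determinant.det (Matrix.mat N N (\<lambda>(i, j). (x (Suc i) - x 0) * (\<Prod>s<j. x (Suc i) - c s)))"
    unfolding cofactor_def
    by (auto simp: mat_delete_def W_def intro!: arg_cong[of _ _ Determinant.det] eq_matI)
  also have "\<dots> = (\<Prod>i<N. x (Suc i) - x 0) *
      Determinant.det (Matrix.mat N N (\<lambda>(i, j). \<Prod>s<j. x (Suc i) - c s))"
    using det_scale_rows_cols[of N "\<lambda>i. x (Suc i) - x 0" "\<lambda>_. 1"] by simp
  also have "\<dots> = (\<Prod>i<N. x (Suc i) - x 0) * (\<Prod>j<N. \<Prod>i<j. x (Suc j) - x (Suc i))"
    by (simp add: Suc.IH)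
  also have "\<dots> = (\<Prod>j<Suc N. \<Prod>i<j. x j - x i)"
    unfolding prod.lessThan_Suc_shift by (simp add: prod.distrib)
  finally show ?case by (simp add: V_def)
qed

section \<open>Partitions and hook lengths\<close>

lemma partitions_antimono: "l \<in> partitions \<Longrightarrow> i \<le> j \<Longrightarrow> l j \<le> l i"
  by (auto simp: partitions_def antimono_def)

lemma finite_partition_support: "l \<in> partitions \<Longrightarrow> finite {i. 0 < l i}"
  by (simp add: partitions_def)

lemma finite_down_closed_eq_lessThan:
  fixes S :: "nat set"
  assumes "finite S" "\<And>i j. j \<in> S \<Longrightarrow> i \<le> j \<Longrightarrow> i \<in> S"
  shows "S = {..<card S}"
proof (cases "S = {}")
  case False
  have "S = {..Max S}"
    using assms(2)[OF Max_in[OF assms(1) False]] Max_ge[OF assms(1)] by blast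
  then have "card S = Suc (Max S)"
    by (metis card_atMost)
  with \<open>S = {..Max S}\<close> show ?thesis
    by (simp add: lessThan_Suc_atMost)
qed simp

lemma column_eq_lessThan:
  assumes "l \<in> partitions"
  shows "{i. j < l i} = {..<ptranspose l j}"
  unfolding ptranspose_def
proof (rule finite_down_closed_eq_lessThan)
  show "finite {i. j < l i}"
    by (rule finite_subset[OF _ finite_partition_support[OF assms]]) auto
  show "i \<in> {i. j < l i}" if "k \<in> {i. j < l i}" "i \<le> k" for i k
    using that partitions_antimono[OF assms, of i k] by auto
qed

text \<open>With this equivalence, comparisons of rows and columns of the diagram become linear
  arithmetic.\<close>

lemma less_ptranspose_iff: "l \<in> partitions \<Longrightarrow> i < ptranspose l j \<longleftrightarrow> j < l i"
  using column_eq_lessThan[of l j] by (simp add: set_eq_iff)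

lemma ptranspose_in_partitions:
  assumes "l \<in> partitions"
  shows "ptranspose l \<in> partitions"
proof -
  have "ptranspose l j \<le> ptranspose l i" if "i \<le> j" for i j
    using that less_ptranspose_iff[OF assms, of "ptranspose l i" i]
      less_ptranspose_iff[OF assms, of "ptranspose l i" j] by linarith
  moreover have "{j. ptranspose l j \<noteq> 0} = {..<l 0}"
    by (auto simp: less_ptranspose_iff[OF assms] simp flip: neq0_conv)
  ultimately show ?thesis by (auto simp: partitions_def antimono_def)
qed

lemma ptranspose_ptranspose:
  assumes "l \<in> partitions"
  shows "ptranspose (ptranspose l) = l"
proof
  fix i
  have "j < ptranspose (ptranspose l) i \<longleftrightarrow> j < l i" for j
    using assms by (simp add: less_ptranspose_iff ptranspose_in_partitions)
  \<comment> \<open>Two naturals with the same strict lower bounds are equal; testing each number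
    against the other suffices.\<close>
  from this[of "l i"] this[of "ptranspose (ptranspose l) i"]
  show "ptranspose (ptranspose l) i = l i" by linarith
qed

lemma plength_le_iff:
  assumes "l \<in> partitions"
  shows "plength l \<le> N \<longleftrightarrow> (\<forall>i\<ge>N. l i = 0)"
proof -
  have "plength l = ptranspose l 0" by (simp add: plength_def ptranspose_def)
  then have "N < plength l \<longleftrightarrow> l N \<noteq> 0"
    using less_ptranspose_iff[OF assms, of N 0] by simp
  then show ?thesis
    using partitions_antimono[OF assms, of N] by (metis le_zero_eq not_less order_refl)
qed

lemma plength_ptranspose:
  assumes "l \<in> partitions"
  shows "plength (ptranspose l) = l 0"
  using fun_cong[OF ptranspose_ptranspose[OF assms], of 0]
  by (simp add: plength_def ptranspose_def[of _ 0])

lemma cells_eq_Sigma: "cells l = (SIGMA i:{i. l i \<noteq> 0}. {..<l i})"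
  by (auto simp: cells_def)

lemma cells_ptranspose: "l \<in> partitions \<Longrightarrow> cells (ptranspose l) = prod.swap ` cells l"
  by (force simp: cells_def less_ptranspose_iff image_iff)

lemma psize_eq_card_cells: "l \<in> partitions \<Longrightarrow> psize l = card (cells l)"
  unfolding cells_eq_Sigma psize_def by (subst card_SigmaI) (auto simp: finite_partition_support)

lemma pb_eq_sum_cells: "l \<in> partitions \<Longrightarrow> pb l = (\<Sum>(i, j)\<in>cells l. i)"
  unfolding cells_eq_Sigma pb_def by (subst sum.Sigma[symmetric]) (auto simp: finite_partition_support mult.commute)

lemma psize_ptranspose: "l \<in> partitions \<Longrightarrow> psize (ptranspose l) = psize l"
  by (simp add: psize_eq_card_cells ptranspose_in_partitions cells_ptranspose card_image)

lemma pb_ptranspose: "l \<in> partitions \<Longrightarrow> pb (ptranspose l) = (\<Sum>(i, j)\<in>cells l. j)"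
  by (simp add: pb_eq_sum_cells ptranspose_in_partitions cells_ptranspose sum.reindex case_prod_unfold)

lemma hook_length_ptranspose: "l \<in> partitions \<Longrightarrow> hook_length (ptranspose l) i j = hook_length l j i"
  by (simp add: hook_length_def ptranspose_ptranspose add.commute diff_commute)

lemma prod_hook_length_ptranspose:
  fixes f :: "nat \<Rightarrow> 'a :: comm_monoid_mult"
  assumes "l \<in> partitions"
  shows "(\<Prod>(i, j)\<in>cells (ptranspose l). f (hook_length (ptranspose l) i j)) =
         (\<Prod>(i, j)\<in>cells l. f (hook_length l i j))"
  using assms
  by (simp add: cells_ptranspose prod.reindex hook_length_ptranspose case_prod_unfold)

text \<open>In row \<open>i\<close> both the arm lengths and the column indices run through
  \<open>{..<l i}\<close>, so they have the same sum.\<close>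

lemma sum_arm_length:
  assumes "l \<in> partitions"
  shows "(\<Sum>(i, j)\<in>cells l. l i - 1 - j) = pb (ptranspose l)"
proof -
  have "(\<Sum>(i, j)\<in>cells l. l i - 1 - j) = (\<Sum>i | l i \<noteq> 0. \<Sum>j<l i. l i - 1 - j)"
    unfolding cells_eq_Sigma by (subst sum.Sigma) (auto simp: finite_partition_support assms)
  also have "\<dots> = (\<Sum>i | l i \<noteq> 0. \<Sum>j<l i. j)"
    using sum.nat_diff_reindex[of "\<lambda>j. j"] by simp
  also have "\<dots> = pb (ptranspose l)"
    unfolding pb_ptranspose[OF assms] cells_eq_Sigma
    by (subst sum.Sigma) (auto simp: finite_partition_support assms)
  finally show ?thesis .
qed

lemma sum_leg_length:
  assumes "l \<in> partitions"
  shows "(\<Sum>(i, j)\<in>cells l. ptranspose l j - 1 - i) = pb l"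
proof -
  have "(\<Sum>(i, j)\<in>cells l. ptranspose l j - 1 - i) =
      (\<Sum>(i, j)\<in>cells (ptranspose l). ptranspose l i - 1 - j)"
    by (simp add: cells_ptranspose assms sum.reindex case_prod_unfold)
  also have "\<dots> = pb l"
    using sum_arm_length[OF ptranspose_in_partitions[OF assms]] by (simp add: ptranspose_ptranspose assms)
  finally show ?thesis .
qed

text \<open>A hook consists of its corner, its leg and its arm. The sum gives the power of
  \<open>q\<close> that appears when \<open>q\<close> is replaced by \<open>1 / q\<close> in the
  hook product.\<close>

lemma sum_hook_length:
  assumes "l \<in> partitions"
  shows "(\<Sum>(i, j)\<in>cells l. hook_length l i j) = psize l + pb l + pb (ptranspose l)"
proof -
  have "(\<Sum>(i, j)\<in>cells l. hook_length l i j) =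
      (\<Sum>c\<in>cells l. 1 + (case c of (i, j) \<Rightarrow> ptranspose l j - 1 - i) + (case c of (i, j) \<Rightarrow> l i - 1 - j))"
  proof (intro sum.cong refl)
    fix c assume "c \<in> cells l"
    then obtain i j where c: "c = (i, j)" and "j < l i" by (auto simp: cells_def)
    then have "i < ptranspose l j" using less_ptranspose_iff[OF assms] by simp
    then show "(case c of (i, j) \<Rightarrow> hook_length l i j) =
        1 + (case c of (i, j) \<Rightarrow> ptranspose l j - 1 - i) + (case c of (i, j) \<Rightarrow> l i - 1 - j)"
      using c \<open>j < l i\<close> by (simp add: hook_length_def)
  qed
  also have "\<dots> = psize l + pb l + pb (ptranspose l)"
    by (simp only: sum.distrib psize_eq_card_cells[OF assms] sum_arm_length[OF assms]
        sum_leg_length[OF assms] card_eq_sum)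
  finally show ?thesis .
qed

text \<open>The hook lengths of row \<open>i\<close> and the differences \<open>L i - L k\<close> (\<open>i < k < N\<close>) of the shifted
  parts \<open>L i = l i + (N - 1 - i)\<close> together run through \<open>{1..L i}\<close>.\<close>

lemma prod_hook_length_row:
  fixes f :: "nat \<Rightarrow> 'a :: comm_monoid_mult"
  assumes l: "l \<in> partitions" and N: "\<And>i. i \<ge> N \<Longrightarrow> l i = 0" and i: "i < N"
  shows "(\<Prod>j<l i. f (hook_length l i j)) * (\<Prod>k\<in>{i<..<N}. f (l i + k - l k - i)) =
         (\<Prod>m=1..l i + (N - 1 - i). f m)"
proof -
  let ?d = "\<lambda>k. l i + k - l k - i"
  define H where "H = hook_length l i ` {..<l i}"
  define D where "D = ?d ` {i<..<N}"
  have tr: "k < ptranspose l j \<longleftrightarrow> j < l k" for j k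
    by (rule less_ptranspose_iff[OF l])
  have tr_mono: "ptranspose l j' \<le> ptranspose l j" if "j \<le> j'" for j j'
    using that partitions_antimono[OF ptranspose_in_partitions[OF l]] by blast
  have tr_le: "ptranspose l j \<le> N" for j
    using tr[of N j] N by (metis leI less_nat_zero_code order_refl)
  have mono: "l k' \<le> l k" if "k \<le> k'" for k k'
    using that partitions_antimono[OF l] by blast
  have injH: "inj_on (hook_length l i) {..<l i}"
  proof (rule linorder_inj_onI')
    fix j j' assume "j \<in> {..<l i}" "j' \<in> {..<l i}" "j < j'"
    then show "hook_length l i j \<noteq> hook_length l i j'"
      using tr_mono[of j j'] tr[of i j] tr[of i j'] unfolding hook_length_def lessThan_iff by linarith
  qed
  have injD: "inj_on ?d {i<..<N}"
  proof (rule linorder_inj_onI')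
    fix k k' assume "k \<in> {i<..<N}" "k' \<in> {i<..<N}" "k < k'"
    then show "?d k \<noteq> ?d k'"
      using mono[of k k'] mono[of i k] mono[of i k'] unfolding greaterThanLessThan_iff by linarith
  qed
  have disj: "H \<inter> D = {}"
  proof -
    have "hook_length l i j \<noteq> ?d k" if "j < l i" "k \<in> {i<..<N}" for j k
    \<comment> \<open>The hook length exceeds \<open>?d k\<close> if \<open>(k, j)\<close> is a cell
      and is smaller than \<open>?d k\<close> otherwise.\<close>
    proof (cases "j < l k")
      case True
      then show ?thesis
        using that tr[of k j] tr[of i j] mono[of i k] unfolding hook_length_def greaterThanLessThan_iff
        by linarith
    next
      case False
      then show ?thesis
        using that tr[of k j] tr[of i j] mono[of i k] unfolding hook_length_def greaterThanLessThan_iff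
        by linarith
    qed
    then show ?thesis unfolding H_def D_def by auto
  qed
  have sub: "H \<union> D \<subseteq> {1..l i + (N - 1 - i)}"
  proof -
    have "hook_length l i j \<in> {1..l i + (N - 1 - i)}" if "j < l i" for j
      using that i tr[of i j] tr_le[of j] unfolding hook_length_def atLeastAtMost_iff by linarith
    moreover have "?d k \<in> {1..l i + (N - 1 - i)}" if "k \<in> {i<..<N}" for k
      using that i mono[of i k] unfolding atLeastAtMost_iff greaterThanLessThan_iff by linarith
    ultimately show ?thesis unfolding H_def D_def by blast
  qed
  have fin: "finite H" "finite D" by (auto simp: H_def D_def)
  \<comment> \<open>Disjointness makes the union as large as the interval containing it, so counting
    replaces a proof of surjectivity.\<close>
  have "card H = l i" "card D = N - 1 - i"
    using card_image[OF injH] card_image[OF injD] by (simp_all only: H_def D_def card_lessThan card_greaterThanLessThan)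
  then have "card (H \<union> D) = l i + (N - 1 - i)"
    using disj fin by (simp add: card_Un_disjoint)
  then have eq: "H \<union> D = {1..l i + (N - 1 - i)}"
    using sub by (intro card_subset_eq) auto
  have "(\<Prod>m=1..l i + (N - 1 - i). f m) = (\<Prod>m\<in>H. f m) * (\<Prod>m\<in>D. f m)"
    unfolding eq[symmetric] using disj fin by (simp add: prod.union_disjoint)
  then show ?thesis
    by (simp only: H_def D_def prod.reindex[OF injH] prod.reindex[OF injD] o_def)
qed

section \<open>Specialised Schur functions\<close>

text \<open>The parts are read from the smallest upwards, and the added staircase makes the order
  strict; \<open>restrict\<close> matches the use of \<open>extensional\<close> in
  \<open>increasing_seqs\<close>.\<close>

definition seq_of_partition :: "nat \<Rightarrow> (nat \<Rightarrow> nat) \<Rightarrow> nat \<Rightarrow> nat" where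
  "seq_of_partition N l = restrict (\<lambda>a. l (N - 1 - a) + a) {0..<N}"

lemma strict_mono_on_nat_diff_le:
  fixes g :: "nat \<Rightarrow> nat"
  assumes "strict_mono_on {0..<N} g" "a \<le> b" "b < N"
  shows "g a + (b - a) \<le> g b"
  using assms(2,3)
proof (induction b rule: dec_induct)
  case (step b)
  then have "g b < g (Suc b)"
    by (intro strict_mono_onD[OF assms(1)]) auto
  with step show ?case by simp
qed simp

text \<open>The inverse subtracts the staircase. A strictly increasing sequence of naturals grows by
  at least one per step, so the truncated subtraction is exact and the differences are weakly
  monotone.\<close>

lemma bij_betw_seq_of_partition:
  "bij_betw (seq_of_partition N) {l \<in> partitions. plength l \<le> N} (increasing_seqs N)"
proof (rule bij_betw_byWitness[where f' = "\<lambda>g i. if i < N then g (N - 1 - i) - (N - 1 - i) else 0"])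
  show "\<forall>l\<in>{l \<in> partitions. plength l \<le> N}.
      (\<lambda>i. if i < N then seq_of_partition N l (N - 1 - i) - (N - 1 - i) else 0) = l"
    by (auto simp: seq_of_partition_def plength_le_iff)
  show "\<forall>g\<in>increasing_seqs N.
      seq_of_partition N (\<lambda>i. if i < N then g (N - 1 - i) - (N - 1 - i) else 0) = g"
  proof
    fix g assume "g \<in> increasing_seqs N"
    then have g: "g \<in> extensional {0..<N}" "strict_mono_on {0..<N} g"
      by (auto simp: increasing_seqs_def)
    show "seq_of_partition N (\<lambda>i. if i < N then g (N - 1 - i) - (N - 1 - i) else 0) = g"
    proof (rule extensionalityI[of _ "{0..<N}"])
      fix a assume "a \<in> {0..<N}"
      then show "seq_of_partition N (\<lambda>i. if i < N then g (N - 1 - i) - (N - 1 - i) else 0) a = g a"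
        using strict_mono_on_nat_diff_le[OF g(2), of 0 a] by (simp add: seq_of_partition_def)
    qed (use g in \<open>auto simp: seq_of_partition_def\<close>)
  qed
  show "seq_of_partition N ` {l \<in> partitions. plength l \<le> N} \<subseteq> increasing_seqs N"
  proof clarify
    fix l assume l: "l \<in> partitions" "plength l \<le> N"
    show "seq_of_partition N l \<in> increasing_seqs N"
      unfolding increasing_seqs_def
    proof (intro CollectI conjI strict_mono_onI)
      fix a b assume "a \<in> {0..<N}" "b \<in> {0..<N}" "a < b"
      moreover have "l (N - 1 - a) \<le> l (N - 1 - b)"
        using \<open>a < b\<close> by (intro partitions_antimono[OF l(1)]) linarith
      ultimately show "seq_of_partition N l a < seq_of_partition N l b"
        by (simp add: seq_of_partition_def)
    qed (simp add: seq_of_partition_def)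
  qed
  show "(\<lambda>g i. if i < N then g (N - 1 - i) - (N - 1 - i) else 0) ` increasing_seqs N
      \<subseteq> {l \<in> partitions. plength l \<le> N}"
  proof clarify
    fix g assume "g \<in> increasing_seqs N"
    then have g: "strict_mono_on {0..<N} g"
      by (auto simp: increasing_seqs_def)
    define l where "l i = (if i < N then g (N - 1 - i) - (N - 1 - i) else 0)" for i
    have "l j \<le> l i" if "i \<le> j" for i j
    proof (cases "j < N")
      case True
      then have "g (N - 1 - j) + ((N - 1 - i) - (N - 1 - j)) \<le> g (N - 1 - i)"
        using that by (intro strict_mono_on_nat_diff_le[OF g]) auto
      with True that show ?thesis by (simp add: l_def)
    qed (simp add: l_def)
    moreover have "finite {i. l i \<noteq> 0}"
      by (rule finite_subset[of _ "{..<N}"]) (auto simp: l_def)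
    ultimately have "l \<in> partitions" by (simp add: partitions_def antimono_def)
    then show "(\<lambda>i. if i < N then g (N - 1 - i) - (N - 1 - i) else 0) \<in> partitions \<and>
        plength (\<lambda>i. if i < N then g (N - 1 - i) - (N - 1 - i) else 0) \<le> N"
      unfolding l_def[symmetric] by (simp add: plength_le_iff) (simp add: l_def)
  qed
qed

lemma q_poch_Suc: "q_poch Q (Suc k) = q_poch Q k * (1 - Q ^ Suc k)"
  by (simp add: q_poch_def)

lemma q_poch_0 [simp]: "q_poch Q 0 = 1"
  by (simp add: q_poch_def)

lemma q_poch_nonzero:
  assumes "\<And>m. m > 0 \<Longrightarrow> Q ^ m \<noteq> 1"
  shows "q_poch Q k \<noteq> 0"
  using assms by (simp add: q_poch_def)

text \<open>The entry \<open>h (x - j)\<close> of the Jacobi-Trudi matrix. The case distinction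
  gives \<open>h\<close> the value 0 at negative indices, where truncated subtraction would yield
  \<open>h 0 = 1\<close>.\<close>

definition shifted_entry :: "real \<Rightarrow> real \<Rightarrow> nat \<Rightarrow> nat \<Rightarrow> real" where
  "shifted_entry \<rho> Q j x = (if j \<le> x then \<rho> ^ (x - j) / q_poch Q (x - j) else 0)"

text \<open>Passing from \<open>j\<close> to \<open>Suc j\<close> multiplies the entry by
  \<open>(1 - Q ^ (x - j)) / \<rho>\<close> for \<open>j \<le> x\<close>. This factor vanishes at
  \<open>x = j\<close>, so the product also accounts for the zero entries with
  \<open>x < j\<close>.\<close>

lemma shifted_entry_eq_newton:
  assumes Q: "Q \<noteq> 0" "\<And>m. m > 0 \<Longrightarrow> Q ^ m \<noteq> 1" and \<rho>: "\<rho> \<noteq> 0"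
  shows "shifted_entry \<rho> Q j x =
         \<rho> ^ x / q_poch Q x * (\<Prod>s<j. - 1 / (\<rho> * Q ^ s)) * (\<Prod>s<j. Q ^ x - Q ^ s)"
proof (induction j)
  case 0
  then show ?case by (simp add: shifted_entry_def)
next
  case (Suc j)
  have "shifted_entry \<rho> Q (Suc j) x = shifted_entry \<rho> Q j x * (- 1 / (\<rho> * Q ^ j) * (Q ^ x - Q ^ j))"
  proof (cases "j < x")
    case True
    define k where "k = x - Suc j"
    have x: "x = j + Suc k" using True by (simp add: k_def)
    have "- 1 / (\<rho> * Q ^ j) * (Q ^ x - Q ^ j) = (1 - Q ^ Suc k) / \<rho>"
      using Q \<rho> by (simp add: x field_simps power_add)
    moreover have "1 - Q ^ Suc k \<noteq> 0" using Q(2)[of "Suc k"] by simp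
    ultimately show ?thesis
      using \<rho> q_poch_nonzero[OF Q(2), of k] by (simp add: shifted_entry_def x q_poch_Suc)
  next
    case False
    then show ?thesis by (cases "j = x") (auto simp: shifted_entry_def)
  qed
  then show ?case by (simp add: Suc.IH)
qed

text \<open>The factor \<open>f i\<close> occurs once for each \<open>k\<close> with
  \<open>i < k < N\<close>.\<close>

lemma prod_lessThan_triangle:
  fixes f :: "nat \<Rightarrow> 'a :: comm_monoid_mult"
  shows "(\<Prod>k<N. \<Prod>i<k. f i) = (\<Prod>i<N. f i ^ (N - 1 - i))"
proof (induction N)
  case (Suc N)
  have "(\<Prod>i<N. f i ^ (N - i)) = (\<Prod>i<N. f i ^ (N - 1 - i) * f i)"
    by (intro prod.cong) (auto simp: power_Suc2[symmetric] Suc_diff_Suc simp del: power_Suc)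
  then show ?case by (simp add: Suc.IH prod.distrib)
qed simp

lemma
  assumes "l \<in> partitions" "plength l \<le> N"
  shows psize_eq_sum_lessThan: "psize l = (\<Sum>i<N. l i)"
    and pb_eq_sum_lessThan: "pb l = (\<Sum>i<N. i * l i)"
    and prod_cells_eq_lessThan: "prod f (cells l) = (\<Prod>i<N. \<Prod>j<l i. f (i, j))"
proof -
  have N: "i < N" if "l i \<noteq> 0" for i
    using that assms by (metis not_less plength_le_iff)
  show "psize l = (\<Sum>i<N. l i)" "pb l = (\<Sum>i<N. i * l i)"
    unfolding psize_def pb_def using N by (auto intro!: sum.mono_neutral_left)
  have "cells l = (SIGMA i:{..<N}. {..<l i})"
    using N by (fastforce simp: cells_def)
  then show "prod f (cells l) = (\<Prod>i<N. \<Prod>j<l i. f (i, j))"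
    by (simp add: prod.Sigma)
qed

text \<open>Scaling rows and columns leaves a Vandermonde determinant in the \<open>Q ^ g k\<close>.
  In row \<open>k\<close> its factors and the hook factors of the part \<open>l (N - 1 - k)\<close>
  multiply to \<open>q_poch Q (g k)\<close>, so dividing by the latter leaves the reciprocal hook
  factors. The argument is algebraic, which permits both \<open>Q = q\<close> and
  \<open>Q = 1 / q\<close>.\<close>

lemma det_shifted_entry:
  assumes l: "l \<in> partitions" "plength l \<le> N"
    and Q: "Q \<noteq> 0" "\<And>m. m > 0 \<Longrightarrow> Q ^ m \<noteq> 1" and \<rho>: "\<rho> \<noteq> 0"
  shows "Determinant.det (Matrix.mat N N (\<lambda>(k, j). shifted_entry \<rho> Q j (seq_of_partition N l k))) =
         \<rho> ^ psize l * Q ^ pb l * (\<Prod>(i, j)\<in>cells l. 1 / (1 - Q ^ hook_length l i j))"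
proof -
  define g where "g k = l (N - 1 - k) + k" for k
  have "Determinant.det (Matrix.mat N N (\<lambda>(k, j). shifted_entry \<rho> Q j (seq_of_partition N l k))) =
      Determinant.det (Matrix.mat N N (\<lambda>(k, j).
        (\<rho> ^ g k / q_poch Q (g k)) * (\<Prod>s<j. - 1 / (\<rho> * Q ^ s)) * (\<Prod>s<j. Q ^ g k - Q ^ s)))"
    using shifted_entry_eq_newton[OF Q \<rho>]
    by (intro arg_cong[of _ _ Determinant.det] eq_matI) (auto simp: seq_of_partition_def g_def)
  also have "\<dots> = (\<Prod>k<N. \<rho> ^ g k / q_poch Q (g k)) * (\<Prod>j<N. \<Prod>s<j. - 1 / (\<rho> * Q ^ s)) *
      (\<Prod>j<N. \<Prod>i<j. Q ^ g j - Q ^ g i)"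
    unfolding det_scale_rows_cols by (simp add: det_newton_vandermonde)
  also have "\<dots> = (\<Prod>k<N. \<rho> ^ g k / q_poch Q (g k) * (\<Prod>i<k. - 1 / (\<rho> * Q ^ i) * (Q ^ g k - Q ^ g i)))"
    by (simp only: prod.distrib mult.assoc)
  also have "\<dots> = (\<Prod>k<N. \<rho> ^ l (N - 1 - k) * (\<Prod>i<k. Q ^ l (N - 1 - i)) *
      (\<Prod>j<l (N - 1 - k). 1 / (1 - Q ^ hook_length l (N - 1 - k) j)))"
  proof (intro prod.cong refl)
    fix k assume "k \<in> {..<N}"
    then have k: "k < N" by simp
    define H where "H = (\<Prod>j<l (N - 1 - k). 1 - Q ^ hook_length l (N - 1 - k) j)"
    define D where "D = (\<Prod>i<k. 1 - Q ^ (g k - g i))"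
    have le: "g i \<le> g k" if "i < k" for i
      using that k partitions_antimono[OF l(1), of "N - 1 - k" "N - 1 - i"] unfolding g_def by linarith
    \<comment> \<open>Taking \<open>- Q ^ g i\<close> out of the difference cancels the sign and the
      \<open>Q ^ i\<close> of the column scaling.\<close>
    have "- 1 / (\<rho> * Q ^ i) * (Q ^ g k - Q ^ g i) = 1 / \<rho> * Q ^ l (N - 1 - i) * (1 - Q ^ (g k - g i))"
      if "i < k" for i
    proof -
      have "Q ^ g k = Q ^ g i * Q ^ (g k - g i)"
        using le[OF that] by (simp flip: power_add)
      moreover have "Q ^ g i = Q ^ l (N - 1 - i) * Q ^ i" by (simp add: g_def power_add)
      ultimately show ?thesis
        using Q(1) \<rho> by (simp add: field_simps)
    qed
    then have "(\<Prod>i<k. - 1 / (\<rho> * Q ^ i) * (Q ^ g k - Q ^ g i)) =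
        (\<Prod>i<k. 1 / \<rho> * Q ^ l (N - 1 - i) * (1 - Q ^ (g k - g i)))"
      by (intro prod.cong) auto
    also have "\<dots> = (1 / \<rho>) ^ k * (\<Prod>i<k. Q ^ l (N - 1 - i)) * D"
      by (simp only: prod.distrib D_def prod_constant card_lessThan)
    finally have prod_eq: "(\<Prod>i<k. - 1 / (\<rho> * Q ^ i) * (Q ^ g k - Q ^ g i)) =
        (1 / \<rho>) ^ k * (\<Prod>i<k. Q ^ l (N - 1 - i)) * D" .
    \<comment> \<open>The reflection of indices at \<open>N - 1\<close> identifies the differences
      of shifted parts with the differences \<open>g k - g i\<close>.\<close>
    have "(\<Prod>k'\<in>{N - 1 - k<..<N}. 1 - Q ^ (l (N - 1 - k) + k' - l k' - (N - 1 - k))) = D"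
      unfolding D_def
      by (rule prod.reindex_bij_witness[of _ "\<lambda>i. N - 1 - i" "\<lambda>k'. N - 1 - k'"])
         (use k in \<open>auto simp: g_def intro!: arg_cong[of _ _ "\<lambda>m. Q ^ m"]\<close>)
    then have "H * D = q_poch Q (g k)"
      using prod_hook_length_row[OF l(1), of N "N - 1 - k" "\<lambda>m. 1 - Q ^ m"] l k
      by (simp add: H_def q_poch_def g_def plength_le_iff)
    then have "H \<noteq> 0" "D \<noteq> 0" "1 / q_poch Q (g k) = 1 / H * (1 / D)"
      using q_poch_nonzero[OF Q(2), of "g k"] by auto
    then have "\<rho> ^ g k / q_poch Q (g k) * ((1 / \<rho>) ^ k * (\<Prod>i<k. Q ^ l (N - 1 - i)) * D) =
        \<rho> ^ l (N - 1 - k) * (\<Prod>i<k. Q ^ l (N - 1 - i)) * (1 / H)"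
      using \<open>H * D = q_poch Q (g k)\<close>[symmetric] \<rho> by (simp add: g_def power_add field_simps)
    then show "\<rho> ^ g k / q_poch Q (g k) * (\<Prod>i<k. - 1 / (\<rho> * Q ^ i) * (Q ^ g k - Q ^ g i)) =
        \<rho> ^ l (N - 1 - k) * (\<Prod>i<k. Q ^ l (N - 1 - i)) *
        (\<Prod>j<l (N - 1 - k). 1 / (1 - Q ^ hook_length l (N - 1 - k) j))"
      unfolding prod_eq by (simp add: H_def prod_dividef)
  qed
  \<comment> \<open>The part with index \<open>N - 1 - i\<close> is collected once for each
    \<open>k > i\<close>, hence as often as its index says; this produces the exponent
    \<open>pb l\<close>.\<close>
  also have "\<dots> = (\<Prod>k<N. \<rho> ^ l (N - Suc k)) * (\<Prod>i<N. Q ^ ((N - Suc i) * l (N - Suc i))) *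
      (\<Prod>k<N. \<Prod>j<l (N - Suc k). 1 / (1 - Q ^ hook_length l (N - Suc k) j))"
    by (simp add: prod.distrib prod_lessThan_triangle power_mult[symmetric] mult.commute)
  also have "\<dots> = (\<Prod>k<N. \<rho> ^ l k) * (\<Prod>i<N. Q ^ (i * l i)) *
      (\<Prod>k<N. \<Prod>j<l k. 1 / (1 - Q ^ hook_length l k j))"
    unfolding prod.nat_diff_reindex[of "\<lambda>k. \<rho> ^ l k"] prod.nat_diff_reindex[of "\<lambda>i. Q ^ (i * l i)"]
      prod.nat_diff_reindex[of "\<lambda>k. \<Prod>j<l k. 1 / (1 - Q ^ hook_length l k j)"] ..
  also have "\<dots> = \<rho> ^ psize l * Q ^ pb l * (\<Prod>(i, j)\<in>cells l. 1 / (1 - Q ^ hook_length l i j))"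
    using l by (simp add: psize_eq_sum_lessThan pb_eq_sum_lessThan prod_cells_eq_lessThan power_sum)
  finally show ?thesis .
qed

section \<open>Convergence, Toeplitz entries and Gessel's identity\<close>

lemma power_neq_1:
  fixes q :: real
  assumes "0 \<le> q" "q \<noteq> 1" "m > 0"
  shows "q ^ m \<noteq> 1"
  using assms power_eq_1_iff[of q m] by auto

lemma q_poch_pos:
  assumes "0 \<le> q" "q < 1"
  shows "q_poch q k > 0"
  unfolding q_poch_def using assms by (intro prod_pos) (auto simp: power_less_one_iff)

text \<open>Successive terms have ratio \<open>r / (1 - q ^ Suc n)\<close>, which tends to
  \<open>r < 1\<close>; any \<open>c\<close> strictly between \<open>r\<close> and 1 serves in the
  ratio test.\<close>

lemma summable_power_div_q_poch:
  assumes "0 \<le> r" "r < 1" "0 \<le> q" "q < 1"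
  shows "summable (\<lambda>k. r ^ k / q_poch q k)"
proof -
  obtain c where c: "r < c" "c < 1" using dense assms by blast
  have "(\<lambda>n. q ^ Suc n) \<longlonglongrightarrow> 0"
    using assms by (intro LIMSEQ_Suc LIMSEQ_realpow_zero)
  then have "(\<lambda>n. r / (1 - q ^ Suc n)) \<longlonglongrightarrow> r / (1 - 0)"
    by (intro tendsto_intros) auto
  then have "eventually (\<lambda>n. r / (1 - q ^ Suc n) < c) sequentially"
    using c by (intro order_tendstoD) auto
  then obtain N where N: "\<And>n. n \<ge> N \<Longrightarrow> r / (1 - q ^ Suc n) < c"
    by (auto simp: eventually_sequentially)
  show ?thesis
  proof (rule summable_ratio_test[OF c(2)])
    fix n assume "n \<ge> N"
    have "norm (r ^ Suc n / q_poch q (Suc n)) = r / (1 - q ^ Suc n) * (r ^ n / q_poch q n)"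
      using assms q_poch_pos[OF assms(3,4)] by (simp add: less_imp_le del: power_Suc) (simp add: q_poch_Suc)
    also have "\<dots> \<le> c * (r ^ n / q_poch q n)"
      using N[OF \<open>n \<ge> N\<close>] assms q_poch_pos[OF assms(3,4)]
      by (intro mult_right_mono) (auto simp: less_imp_le)
    finally show "norm (r ^ Suc n / q_poch q (Suc n)) \<le> c * norm (r ^ n / q_poch q n)"
      using assms q_poch_pos[OF assms(3,4)] by (simp add: less_imp_le)
  qed
qed

text \<open>One factor is dominated by a shift of the summable \<open>u\<close>, the other by the
  constant \<open>C\<close>, since no term of a nonnegative series exceeds its sum.\<close>

lemma summable_on_shifted_mult:
  fixes u w :: "nat \<Rightarrow> real"
  assumes u: "summable u" and le: "\<And>k. \<bar>w k\<bar> \<le> u k"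
  shows "(\<lambda>x. (if i \<le> x then w (x - i) else 0) * (if j \<le> x then w (x - j) else 0)) summable_on UNIV"
proof -
  define C where "C = suminf u"
  have u0: "0 \<le> u k" for k using le[of k] by linarith
  have wC: "\<bar>w k\<bar> \<le> C" for k
    using le[of k] sum_le_suminf[OF u, of "{k}"] u0 unfolding C_def by simp
  have C0: "0 \<le> C" using wC[of 0] by linarith
  define s where "s x = (if i \<le> x then u (x - i) else 0)" for x
  have "summable s"
    using u summable_iff_shift[of s i] by (simp add: s_def)
  then have sC: "summable (\<lambda>x. s x * C)" by (rule summable_mult2)
  define p where
    "p x = (if i \<le> x then w (x - i) else 0) * (if j \<le> x then w (x - j) else 0)" for x
  have "norm (norm (p x)) \<le> s x * C" for x
    using mult_mono[OF le[of "x - i"] wC[of "x - j"] u0 abs_ge_zero] mult_nonneg_nonneg[OF u0 C0, of "x - i"]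
    by (simp add: p_def s_def abs_mult)
  then have "summable (\<lambda>x. norm (p x))"
    by (rule summable_comparison_test'[OF sC])
  then show ?thesis unfolding p_def by (rule norm_summable_imp_summable_on)
qed

text \<open>Formally the coefficient of \<open>z ^ n\<close> in \<open>W z * W (1 / z)\<close>,
  where \<open>W\<close> is the generating function of \<open>w\<close>. The index set is that of
  the Bessel series, so the two can be compared termwise.\<close>

definition toeplitz_entry :: "(nat \<Rightarrow> real) \<Rightarrow> int \<Rightarrow> real" where
  "toeplitz_entry w n = (\<Sum>\<^sub>\<infinity>k\<in>{k::nat. max 0 (- n) \<le> int k}. w k * w (nat (n + int k)))"

text \<open>Only \<open>x \<ge> max i j\<close> contributes, and the substitution
  \<open>x = k + j\<close> makes the sum depend on \<open>j - i\<close> alone.\<close>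

lemma infsum_shifted_mult:
  "(\<Sum>\<^sub>\<infinity>x. (if i \<le> x then w (x - i) else 0) * (if j \<le> x then w (x - j) else 0)) =
     toeplitz_entry w (- int i + int j)"
proof -
  have "(\<Sum>\<^sub>\<infinity>x. (if i \<le> x then w (x - i) else 0) * (if j \<le> x then w (x - j) else 0)) =
      (\<Sum>\<^sub>\<infinity>x\<in>{max i j..}. w (x - i) * w (x - j))"
    by (rule infsum_cong_neutral) auto
  also have "\<dots> = toeplitz_entry w (- int i + int j)"
    unfolding toeplitz_entry_def
  proof (rule infsum_reindex_bij_witness[of _ "\<lambda>k. k + j" "\<lambda>x. x - j"])
    fix x assume "x \<in> {max i j..}"
    then show "w (x - j) * w (nat (- int i + int j + int (x - j))) = w (x - i) * w (x - j)"
      by (simp add: of_nat_diff nat_diff_distrib' mult.commute)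
  qed (simp_all, linarith?)
  finally show ?thesis .
qed

text \<open>The Schur function $s_l(r, rq, rq^2, \dots)$ in its hook product form.\<close>

definition schur_spec :: "real \<Rightarrow> real \<Rightarrow> (nat \<Rightarrow> nat) \<Rightarrow> real" where
  "schur_spec r q l = r ^ psize l * q ^ pb l * (\<Prod>(i, j)\<in>cells l. 1 / (1 - q ^ hook_length l i j))"

text \<open>Cauchy-Binet with both families equal to \<open>shifted_entry\<close> sums the squared
  minors, which are then indexed by partitions. The dominating series \<open>u\<close> is a
  parameter because the identity is also applied with a negative \<open>\<rho>\<close> and with
  \<open>Q > 1\<close>.\<close>

lemma gessel_identity:
  fixes \<rho> Q :: real
  assumes Q: "Q \<noteq> 0" "\<And>m. m > 0 \<Longrightarrow> Q ^ m \<noteq> 1" and \<rho>: "\<rho> \<noteq> 0"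
    and u: "summable u" "\<And>k. \<bar>\<rho> ^ k / q_poch Q k\<bar> \<le> u k"
  shows "((\<lambda>l. (schur_spec \<rho> Q l)\<^sup>2) has_sum
      Determinant.det (Matrix.mat N N (\<lambda>(i, j). toeplitz_entry (\<lambda>k. \<rho> ^ k / q_poch Q k) (- int i + int j))))
      {l \<in> partitions. plength l \<le> N}"
proof -
  have "((\<lambda>g. Determinant.det (Matrix.mat N N (\<lambda>(k, i). shifted_entry \<rho> Q i (g k))) *
              Determinant.det (Matrix.mat N N (\<lambda>(k, j). shifted_entry \<rho> Q j (g k)))) has_sum
          Determinant.det (Matrix.mat N N (\<lambda>(i, j). \<Sum>\<^sub>\<infinity>x. shifted_entry \<rho> Q i x * shifted_entry \<rho> Q j x)))
        (increasing_seqs N)"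
    unfolding shifted_entry_def using summable_on_shifted_mult[OF u]
    by (intro cauchy_binet_infinite) auto
  moreover have "(\<Sum>\<^sub>\<infinity>x. shifted_entry \<rho> Q i x * shifted_entry \<rho> Q j x) =
      toeplitz_entry (\<lambda>k. \<rho> ^ k / q_poch Q k) (- int i + int j)" for i j
    unfolding shifted_entry_def by (rule infsum_shifted_mult)
  ultimately have sum: "((\<lambda>g. (Determinant.det (Matrix.mat N N (\<lambda>(k, j). shifted_entry \<rho> Q j (g k))))\<^sup>2) has_sum
      Determinant.det (Matrix.mat N N (\<lambda>(i, j). toeplitz_entry (\<lambda>k. \<rho> ^ k / q_poch Q k) (- int i + int j))))
      (increasing_seqs N)"
    by (simp only: power2_eq_square)
  from iffD2[OF has_sum_reindex_bij_betw[OF bij_betw_seq_of_partition] sum] show ?thesis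
    by (rule iffD1[OF has_sum_cong, rotated])
       (simp add: det_shifted_entry[OF _ _ Q \<rho>] schur_spec_def)
qed

section \<open>Inverting the base and transposing the partition\<close>

text \<open>Each hook factor changes by \<open>- (q ^ h)\<close>. By the sum of the hook lengths
  these changes cancel the sign and the negative powers of \<open>q\<close> and leave
  \<open>q ^ pb (ptranspose l)\<close>; the hook product itself is invariant under
  transposition.\<close>

lemma schur_spec_inverse_base:
  assumes l: "l \<in> partitions" and q: "0 < q" "q < 1"
  shows "schur_spec (- r / q) (1 / q) l = schur_spec r q (ptranspose l)"
proof -
  have q_hooks: "(\<Prod>(i, j)\<in>cells l. q ^ hook_length l i j) = q ^ (psize l + pb l + pb (ptranspose l))"
    by (simp only: sum_hook_length[OF l, symmetric] power_sum case_prod_unfold)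
  define H where "H = (\<Prod>(i, j)\<in>cells l. 1 / (1 - q ^ hook_length l i j))"
  have "1 / (1 - (1 / q) ^ h) = - 1 * q ^ h * (1 / (1 - q ^ h))" if "h > 0" for h
  proof -
    have "q ^ h \<noteq> 1" "q ^ h > 0" using q that by (auto simp: power_neq_1)
    then show ?thesis using q by (simp add: power_one_over divide_simps) (simp add: algebra_simps)
  qed
  moreover have "hook_length l i j > 0" if "(i, j) \<in> cells l" for i j
    using that less_ptranspose_iff[OF l, of i j] by (simp add: hook_length_def cells_def)
  ultimately have "(\<Prod>(i, j)\<in>cells l. 1 / (1 - (1 / q) ^ hook_length l i j)) =
      (\<Prod>c\<in>cells l. - 1 * (case c of (i, j) \<Rightarrow> q ^ hook_length l i j) *
        (case c of (i, j) \<Rightarrow> 1 / (1 - q ^ hook_length l i j)))"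
    by (intro prod.cong) auto
  also have "\<dots> = (- 1) ^ psize l * q ^ (psize l + pb l + pb (ptranspose l)) * H"
    by (simp only: prod.distrib prod_constant psize_eq_card_cells[OF l, symmetric] q_hooks H_def)
  finally have "schur_spec (- r / q) (1 / q) l =
      (- r / q) ^ psize l * (1 / q) ^ pb l * ((- 1) ^ psize l * (q ^ psize l * q ^ pb l * q ^ pb (ptranspose l)) * H)"
    by (simp only: schur_spec_def power_add)
  also have "\<dots> = ((- r / q) ^ psize l * (- 1) ^ psize l * q ^ psize l) * ((1 / q) ^ pb l * q ^ pb l) *
      q ^ pb (ptranspose l) * H"
    by (simp only: mult_ac)
  also have "\<dots> = ((- r / q) * (- 1) * q) ^ psize l * ((1 / q) * q) ^ pb l * q ^ pb (ptranspose l) * H"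
    by (simp only: power_mult_distrib)
  also have "\<dots> = r ^ psize l * q ^ pb (ptranspose l) * H"
    using q by simp
  also have "\<dots> = schur_spec r q (ptranspose l)"
    by (simp only: schur_spec_def psize_ptranspose[OF l] H_def
        prod_hook_length_ptranspose[OF l, of "\<lambda>h. 1 / (1 - q ^ h)"])
  finally show ?thesis .
qed

text \<open>Raising \<open>k\<close> by one multiplies either side by
  \<open>r * q ^ k / (1 - q ^ Suc k)\<close>, and the exponents \<open>0, ..., k - 1\<close> of
  \<open>q\<close> add up to \<open>k choose 2\<close>.\<close>

lemma power_div_q_poch_inverse_base:
  assumes "0 < q" "q < 1"
  shows "(- r / q) ^ k / q_poch (1 / q) k = r ^ k * q ^ (k choose 2) / q_poch q k"
proof (induction k)
  case (Suc k)
  have "q ^ Suc k \<noteq> 1" "q ^ Suc k > 0" using assms power_neq_1[of q "Suc k"] by auto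
  then have e1: "- r / q / (1 - (1 / q) ^ Suc k) = r * q ^ k / (1 - q ^ Suc k)"
    using assms by (simp add: power_one_over divide_simps) (simp add: algebra_simps)
  have e2: "(- r / q) ^ Suc k / q_poch (1 / q) (Suc k) =
      (- r / q) ^ k / q_poch (1 / q) k * (- r / q / (1 - (1 / q) ^ Suc k))"
    by (simp only: q_poch_Suc power_Suc2 times_divide_times_eq)
  have e3: "r ^ Suc k * q ^ (Suc k choose 2) / q_poch q (Suc k) =
      r ^ k * q ^ (k choose 2) / q_poch q k * (r * q ^ k / (1 - q ^ Suc k))"
    unfolding q_poch_Suc by (simp add: numeral_2_eq_2 power_add)
  show ?case unfolding e2 e3 Suc.IH e1 ..
qed (simp add: binomial_eq_0)

lemma schur_spec_0:
  assumes "l \<in> partitions"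
  shows "schur_spec 0 q l = (if l = (\<lambda>_. 0) then 1 else 0)"
proof (cases "l = (\<lambda>_. 0)")
  case False
  then obtain i where "l i \<noteq> 0" by auto
  then have "psize l \<noteq> 0"
    using finite_partition_support[OF assms] by (auto simp: psize_def)
  with False show ?thesis by (simp add: schur_spec_def)
qed (simp add: schur_spec_def psize_def pb_def cells_def)

text \<open>Division by \<open>r\<close> and by \<open>q\<close> excludes \<open>r = 0\<close> from the main argument; there only the
  empty partition has nonzero weight and the Toeplitz matrix is the identity.\<close>

lemma has_sum_schur_spec_0:
  assumes "(\<lambda>_. 0) \<in> A" "A \<subseteq> partitions" "w 0 = 1" "\<And>k. k > 0 \<Longrightarrow> w k = 0"
  shows "((\<lambda>l. (schur_spec 0 q l)\<^sup>2) has_sum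
      Determinant.det (Matrix.mat N N (\<lambda>(i, j). toeplitz_entry w (- int i + int j)))) A"
proof -
  have "toeplitz_entry w n = (if n = 0 then 1 else 0)" for n
  proof -
    have "toeplitz_entry w n = (\<Sum>\<^sub>\<infinity>k\<in>(if n = 0 then {0::nat} else {}). 1)"
      unfolding toeplitz_entry_def
    proof (rule infsum_cong_neutral)
      fix k assume "k \<in> {k. max 0 (- n) \<le> int k} - (if n = 0 then {0} else {})"
      then have "k > 0 \<or> nat (n + int k) > 0" by (auto split: if_splits)
      then show "w k * w (nat (n + int k)) = 0" using assms(4) by auto
    qed (auto simp: assms(3) split: if_splits)
    then show ?thesis by simp
  qed
  then have "Matrix.mat N N (\<lambda>(i, j). toeplitz_entry w (- int i + int j)) = 1\<^sub>m N"
    by (intro eq_matI) auto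
  then have det: "Determinant.det (Matrix.mat N N (\<lambda>(i, j). toeplitz_entry w (- int i + int j))) = 1"
    by simp
  have "((\<lambda>l. (schur_spec 0 q l)\<^sup>2) has_sum 1) {\<lambda>_. 0}"
    using assms(1,2) by (intro has_sum_finiteI) (auto simp: schur_spec_0 subset_iff)
  then show ?thesis
    unfolding det by (rule iffD1[OF has_sum_cong_neutral, rotated 3])
      (use assms(1,2) in \<open>auto simp: schur_spec_0 subset_iff\<close>)
qed

lemma zero_in_partitions: "(\<lambda>_. 0) \<in> partitions"
  by (simp add: partitions_def antimono_def)

text \<open>The last hypothesis holds for \<open>r = \<xi> * sqrt q\<close>; in the case
  \<open>r \<noteq> 0\<close> it supplies the \<open>Q \<noteq> 0\<close> required by Gessel's
  identity.\<close>

lemma has_sum_schur_spec_plength: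
  assumes "0 \<le> r" "r < 1" "0 \<le> q" "q < 1" "q = 0 \<Longrightarrow> r = 0"
  shows "((\<lambda>l. (schur_spec r q l)\<^sup>2) has_sum
      Determinant.det (Matrix.mat N N (\<lambda>(i, j). toeplitz_entry (\<lambda>k. r ^ k / q_poch q k) (- int i + int j))))
      {l \<in> partitions. plength l \<le> N}"
proof (cases "r = 0")
  case True
  then show ?thesis
    by (simp only: True, intro has_sum_schur_spec_0) (auto simp: zero_in_partitions plength_def)
next
  case False
  then show ?thesis
    using assms summable_power_div_q_poch[of r q] q_poch_pos[of q]
    by (intro gessel_identity[where u = "\<lambda>k. r ^ k / q_poch q k"]) (auto simp: power_neq_1 less_imp_le)
qed

lemma bij_betw_ptranspose:
  "bij_betw ptranspose {l \<in> partitions. plength l \<le> N} {l \<in> partitions. l 0 \<le> N}"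
  by (rule bij_betw_byWitness[where f' = ptranspose])
     (auto simp: ptranspose_in_partitions ptranspose_ptranspose plength_ptranspose,
      metis plength_ptranspose ptranspose_in_partitions ptranspose_ptranspose)

text \<open>Gessel's identity at \<open>(- r / q, 1 / q)\<close> sums the squares for the transposes
  of the partitions with at most \<open>N\<close> parts, and those transposes are the partitions
  with \<open>l 0 \<le> N\<close>.\<close>

lemma has_sum_schur_spec_largest_part:
  assumes "0 \<le> r" "r < 1" "0 \<le> q" "q < 1" "q = 0 \<Longrightarrow> r = 0"
  shows "((\<lambda>l. (schur_spec r q l)\<^sup>2) has_sum
      Determinant.det (Matrix.mat N N (\<lambda>(i, j).
        toeplitz_entry (\<lambda>k. r ^ k * q ^ (k choose 2) / q_poch q k) (- int i + int j))))
      {l \<in> partitions. l 0 \<le> N}"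
proof (cases "r = 0")
  case True
  then show ?thesis
    by (simp only: True, intro has_sum_schur_spec_0) (auto simp: zero_in_partitions binomial_eq_0)
next
  case False
  then have q: "0 < q" using assms by (cases "q = 0") auto
  have entry: "(\<lambda>k. r ^ k * q ^ (k choose 2) / q_poch q k) = (\<lambda>k. (- r / q) ^ k / q_poch (1 / q) k)"
    by (rule ext) (simp only: power_div_q_poch_inverse_base[OF q assms(4)])
  \<comment> \<open>As \<open>q ^ (k choose 2) \<le> 1\<close>, the dominating series of the first
    formula serves again.\<close>
  have "\<bar>(- r / q) ^ k / q_poch (1 / q) k\<bar> \<le> r ^ k / q_poch q k" for k
  proof -
    have "r ^ k * q ^ (k choose 2) \<le> r ^ k * 1"
      using assms by (intro mult_left_mono power_le_one) auto
    then show ?thesis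
      unfolding power_div_q_poch_inverse_base[OF q assms(4)]
      using assms q_poch_pos[of q k] by (simp add: abs_mult divide_right_mono)
  qed
  moreover have "(1 / q) ^ m \<noteq> 1" if "m > 0" for m
    using power_neq_1[of q m] that q assms by (auto simp: power_one_over)
  ultimately have "((\<lambda>l. (schur_spec (- r / q) (1 / q) l)\<^sup>2) has_sum
      Determinant.det (Matrix.mat N N (\<lambda>(i, j).
        toeplitz_entry (\<lambda>k. (- r / q) ^ k / q_poch (1 / q) k) (- int i + int j))))
      {l \<in> partitions. plength l \<le> N}"
    using q False assms summable_power_div_q_poch[of r q]
    by (intro gessel_identity[where u = "\<lambda>k. r ^ k / q_poch q k"]) auto
  then have "((\<lambda>l. (schur_spec r q (ptranspose l))\<^sup>2) has_sum
      Determinant.det (Matrix.mat N N (\<lambda>(i, j).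
        toeplitz_entry (\<lambda>k. r ^ k * q ^ (k choose 2) / q_poch q k) (- int i + int j))))
      {l \<in> partitions. plength l \<le> N}"
    unfolding entry
    by (rule iffD1[OF has_sum_cong, rotated]) (simp only: mem_Collect_eq schur_spec_inverse_base[OF _ q assms(4)])
  then show ?thesis
    by (rule iffD1[OF has_sum_reindex_bij_betw[OF bij_betw_ptranspose]])
qed

section \<open>Bessel functions as Toeplitz entries\<close>

lemma I_entry_eq_toeplitz_entry:
  "I_entry \<xi> q n = toeplitz_entry (\<lambda>k. (\<xi> * sqrt q) ^ k / q_poch q k) n"
  unfolding I_entry_def q_Bessel_I1_def toeplitz_entry_def
proof (rule infsum_cong)
  fix k :: nat assume "k \<in> {k. max 0 (- n) \<le> int k}"
  then have "nat (n + 2 * int k) = k + nat (n + int k)" by auto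
  then show "(2 * \<xi> * sqrt q / 2) ^ nat (n + 2 * int k) / (q_poch q k * q_poch q (nat (n + int k))) =
      (\<xi> * sqrt q) ^ k / q_poch q k * ((\<xi> * sqrt q) ^ nat (n + int k) / q_poch q (nat (n + int k)))"
    by (simp add: power_add)
qed

text \<open>In powers of \<open>sqrt q\<close> the two exponents are \<open>k\<close> and
  \<open>k * (k - 1)\<close>.\<close>

lemma sqrt_power_mult_choose_2:
  assumes "0 \<le> q"
  shows "sqrt q ^ k * q ^ (k choose 2) = sqrt q ^ (k * k)"
proof (induction k)
  case (Suc k)
  have "sqrt q ^ Suc k * q ^ (Suc k choose 2) = sqrt q * (sqrt q ^ k * q ^ (k choose 2)) * q ^ k"
    by (simp add: numeral_2_eq_2 power_add)
  also have "q ^ k = sqrt q ^ (2 * k)" using assms by (simp add: power_mult)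
  finally show ?case by (simp add: Suc.IH power_add[symmetric] power_Suc[symmetric] mult_2 add_ac del: power_Suc)
qed (simp add: binomial_eq_0)

lemma I_check_entry_eq_toeplitz_entry:
  assumes q: "0 \<le> q"
  shows "I_check_entry \<xi> q n = toeplitz_entry (\<lambda>k. (\<xi> * sqrt q) ^ k * q ^ (k choose 2) / q_poch q k) n"
  unfolding I_check_entry_def q_Bessel_I2_def toeplitz_entry_def infsum_cmult_right'[symmetric]
proof (rule infsum_cong)
  fix k :: nat assume "k \<in> {k. max 0 (- n) \<le> int k}"
  define m where "m = nat (n + int k)"
  then have n: "n = int m - int k" using \<open>k \<in> _\<close> by auto
  have e1: "nat (n + 2 * int k) = k + m" "nat (int k * (int k + n)) = k * m"
    by (simp_all add: n nat_mult_distrib)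
  \<comment> \<open>Completing the square with \<open>n = m - k\<close> separates the power of
    \<open>q\<close> into one factor for each of the indices \<open>k\<close> and
    \<open>m\<close>.\<close>
  have e2: "nat (n\<^sup>2) + 2 * (k * m) = k * k + m * m"
  proof -
    have "int (nat (n\<^sup>2) + 2 * (k * m)) = n\<^sup>2 + 2 * (int k * int m)" by simp
    also have "\<dots> = int (k * k + m * m)"
      by (simp add: n power2_eq_square algebra_simps)
    finally have "int (nat (n\<^sup>2) + 2 * (k * m)) = int (k * k + m * m)" .
    then show ?thesis by (simp only: of_nat_eq_iff)
  qed
  have "sqrt q ^ nat (n\<^sup>2) * q ^ (k * m) = sqrt q ^ (nat (n\<^sup>2) + 2 * (k * m))"
    using q by (simp add: power_add power_mult)
  also have "\<dots> = (sqrt q ^ k * q ^ (k choose 2)) * (sqrt q ^ m * q ^ (m choose 2))"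
    unfolding e2 sqrt_power_mult_choose_2[OF q] by (simp add: power_add)
  finally have "sqrt q ^ nat (n\<^sup>2) * q ^ (k * m) * \<xi> ^ (k + m) =
      ((\<xi> * sqrt q) ^ k * q ^ (k choose 2)) * ((\<xi> * sqrt q) ^ m * q ^ (m choose 2))"
    by (simp add: power_add power_mult_distrib mult_ac)
  then show "sqrt q ^ nat (n\<^sup>2) * (q ^ nat (int k * (int k + n)) * (2 * \<xi> / 2) ^ nat (n + 2 * int k) /
        (q_poch q k * q_poch q (nat (n + int k)))) =
      (\<xi> * sqrt q) ^ k * q ^ (k choose 2) / q_poch q k *
        ((\<xi> * sqrt q) ^ nat (n + int k) * q ^ (nat (n + int k) choose 2) / q_poch q (nat (n + int k)))"
    unfolding e1 m_def[symmetric] by (simp add: mult_ac)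
qed

section \<open>From series to probabilities\<close>

text \<open>The sign matters because \<open>ennreal\<close> would send negative weights to 0. It
  passes from the partial products to the limit once convergence is known, and that follows from
  Bernoulli's inequality, which bounds the deviation of the \<open>n\<close>-th denominator from 1
  by \<open>Suc n * q ^ n\<close>.\<close>

lemma macmahon_nonneg:
  assumes "0 \<le> q" "q < 1" "0 \<le> \<xi>" "\<xi> < 1"
  shows "0 \<le> macmahon \<xi> q"
proof -
  define y where "y n = \<xi>\<^sup>2 * q ^ Suc n" for n
  have \<xi>: "\<xi>\<^sup>2 < 1" using assms by (simp add: power_less_one_iff)
  have y: "0 \<le> y n" "y n < 1" for n
  proof -
    show "0 \<le> y n" using assms by (simp add: y_def)
    have "y n \<le> \<xi>\<^sup>2 * 1"
      unfolding y_def using assms by (intro mult_left_mono power_le_one) auto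
    then show "y n < 1" using \<xi> by simp
  qed
  have bd: "norm (norm ((1 - y n) ^ Suc n - 1)) \<le> of_nat (Suc n) * q ^ n" for n
  proof -
    have "1 - of_nat (Suc n) * y n \<le> (1 - y n) ^ Suc n"
      using Bernoulli_inequality[of "- y n" "Suc n"] y[of n] by (simp del: of_nat_Suc power_Suc)
    moreover have "(1 - y n) ^ Suc n \<le> 1"
      using y[of n] by (intro power_le_one) auto
    moreover have "y n \<le> 1 * q ^ n"
    proof -
      have "y n = (\<xi>\<^sup>2 * q) * q ^ n" by (simp add: y_def)
      also have "\<dots> \<le> 1 * q ^ n"
        using assms \<xi> mult_le_one[of "\<xi>\<^sup>2" q] by (intro mult_right_mono) auto
      finally show ?thesis .
    qed
    then have "of_nat (Suc n) * y n \<le> of_nat (Suc n) * q ^ n"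
      by (intro mult_left_mono) auto
    moreover have "0 \<le> of_nat (Suc n) * q ^ n" using assms by simp
    ultimately have "\<bar>(1 - y n) ^ Suc n - 1\<bar> \<le> of_nat (Suc n) * q ^ n"
      by (intro abs_leI) linarith+
    then show ?thesis by (simp del: of_nat_Suc power_Suc)
  qed
  have "summable (\<lambda>n. of_nat (Suc n) * q ^ n)"
    using geometric_deriv_sums[of q] assms by (simp add: sums_iff)
  then have "summable (\<lambda>n. norm ((1 - y n) ^ Suc n - 1))"
    by (rule summable_comparison_test') (rule bd)
  then have "convergent_prod (\<lambda>n. (1 - y n) ^ Suc n)"
    by (intro abs_convergent_prod_imp_convergent_prod summable_imp_abs_convergent_prod)
  then have "convergent_prod (\<lambda>n. inverse ((1 - y n) ^ Suc n))"
    by (simp only: convergent_prod_inverse_iff)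
  then have "(\<lambda>n. \<Prod>i\<le>n. inverse ((1 - y i) ^ Suc i)) \<longlonglongrightarrow> macmahon \<xi> q"
    unfolding macmahon_def y_def inverse_eq_divide by (rule convergent_prod_LIMSEQ)
  then show ?thesis
    by (rule LIMSEQ_le_const) (use y in \<open>auto intro!: exI[of _ 0] prod_nonneg simp: less_imp_le\<close>)
qed

lemma qPP_S_weight_eq_schur_spec:
  assumes "0 \<le> q"
  shows "qPP_S_weight \<xi> q l = inverse (macmahon \<xi> q) * (schur_spec (\<xi> * sqrt q) q l)\<^sup>2"
proof -
  have "((\<xi> * sqrt q) ^ psize l)\<^sup>2 = ((\<xi> * sqrt q)\<^sup>2) ^ psize l"
    by (simp only: power_even_eq[symmetric] power_mult)
  also have "(\<xi> * sqrt q)\<^sup>2 = \<xi>\<^sup>2 * q"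
    using assms by (simp add: power_mult_distrib)
  finally have e1: "((\<xi> * sqrt q) ^ psize l)\<^sup>2 = (\<xi>\<^sup>2 * q) ^ psize l" .
  have e2: "(\<Prod>(i, j)\<in>cells l. 1 / (1 - q ^ hook_length l i j)\<^sup>2) =
      (\<Prod>(i, j)\<in>cells l. 1 / (1 - q ^ hook_length l i j))\<^sup>2"
    by (simp add: prod_power_distrib case_prod_unfold power_one_over)
  have sq: "(x * y * z)\<^sup>2 = x\<^sup>2 * y\<^sup>2 * z\<^sup>2" for x y z :: real
    by (simp only: power_mult_distrib)
  show ?thesis
    unfolding qPP_S_weight_def schur_spec_def sq e1 e2 power_even_eq by (simp only: mult.assoc)
qed

text \<open>Nonnegativity makes \<open>ennreal\<close> lossless on \<open>X\<close>, so the measure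
  of \<open>A\<close> is the integral of \<open>f\<close> over the counting measure on
  \<open>A\<close>, that is, its sum.\<close>

lemma measure_point_measure_has_sum:
  assumes "(f has_sum s) A" "A \<subseteq> X" "\<And>x. x \<in> X \<Longrightarrow> 0 \<le> f x"
  shows "measure (point_measure X (\<lambda>x. ennreal (f x))) A = s"
proof -
  have sm: "Infinite_Set_Sum.abs_summable_on f A"
    by (rule iffD1[OF abs_summable_equivalent
          iffD1[OF summable_on_iff_abs_summable_on_real has_sum_imp_summable[OF assms(1)]]])
  have "emeasure (point_measure X (\<lambda>x. ennreal (f x))) A =
      (\<integral>\<^sup>+x. ennreal (f x) * indicator A x \<partial>count_space X)"
    unfolding point_measure_def using assms(2) by (subst emeasure_density) auto
  also have "\<dots> = (\<integral>\<^sup>+x. ennreal (f x) \<partial>count_space A)"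
    using assms(2) nn_integral_restrict_space[of A "count_space X" "\<lambda>x. ennreal (f x)"]
    by (simp add: restrict_count_space Int_absorb2)
  also have "\<dots> = ennreal s"
    using assms infsetsum_infsum[OF sm] sm
    by (subst nn_integral_conv_infsetsum) (auto simp: infsumI)
  finally show ?thesis
    using has_sum_nonneg[OF assms(1)] assms(2,3) by (simp add: measure_def subset_iff)
qed

lemma prob_qPP_S:
  assumes "0 \<le> q" "q < 1" "0 \<le> \<xi>" "\<xi> < 1"
    and "((\<lambda>l. (schur_spec (\<xi> * sqrt q) q l)\<^sup>2) has_sum s) {l \<in> partitions. P l}"
  shows "\<P>(l in qPP_S \<xi> q. P l) = 1 / macmahon \<xi> q * s"
proof -
  have "(qPP_S_weight \<xi> q has_sum inverse (macmahon \<xi> q) * s) {l \<in> partitions. P l}"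
    using has_sum_cmult_right[OF assms(5), of "inverse (macmahon \<xi> q)"]
    unfolding qPP_S_weight_eq_schur_spec[OF assms(1), symmetric] .
  moreover have "0 \<le> qPP_S_weight \<xi> q l" for l
    using macmahon_nonneg[OF assms(1-4)] by (simp add: qPP_S_weight_eq_schur_spec[OF assms(1)])
  ultimately show ?thesis
    by (simp add: qPP_S_def space_point_measure measure_point_measure_has_sum inverse_eq_divide)
qed

theorem proposition1p2:
  fixes q \<xi> :: real and N :: nat
  assumes "0 \<le> q" "q < 1" "0 \<le> \<xi>" "\<xi> < 1" "N \<ge> 1"
  shows "\<P>(l in qPP_S \<xi> q. plength l \<le> N) =
           1 / macmahon \<xi> q * Determinant.det (Matrix.mat N N (\<lambda>(i, j). I_entry \<xi> q (- int i + int j))) \<and>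
         \<P>(l in qPP_S \<xi> q. l 0 \<le> N) =
           1 / macmahon \<xi> q * Determinant.det (Matrix.mat N N (\<lambda>(i, j). I_check_entry \<xi> q (- int i + int j)))"
proof -
  have r: "0 \<le> \<xi> * sqrt q" "\<xi> * sqrt q < 1" "q = 0 \<Longrightarrow> \<xi> * sqrt q = 0"
  proof -
    have "\<xi> * sqrt q \<le> \<xi> * 1" using assms by (intro mult_left_mono) auto
    then show "\<xi> * sqrt q < 1" using assms by simp
  qed (use assms in auto)
  show ?thesis
    unfolding I_entry_eq_toeplitz_entry I_check_entry_eq_toeplitz_entry[OF assms(1)]
    using prob_qPP_S[OF assms(1-4) has_sum_schur_spec_plength[OF r(1,2) assms(1,2) r(3)]]
      prob_qPP_S[OF assms(1-4) has_sum_schur_spec_largest_part[OF r(1,2) assms(1,2) r(3)]]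
    by blast
qed

end
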